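(* For all integers $1 \leq s \leq k \leq m$, $$A_{s+2,k+1}(m+1) \leq \zeta_{s,k}(m).$$
   Context: All sequences are finite. A block is a contiguous, possibly empty, segment of a sequence whose letters are pairwise distinct. A sequence is on $m$ blocks if it is given as a concatenation of $m$ consecutive blocks. An alternation of length $s$ is a sequence $abab\cdots$ of length $s$ with $a \neq b$ distinct letters. A sequence avoids alternations of length $s$ if none of its (not necessarily contiguous) subsequences is an alternation of length $s$. For positive integers $s,k,m$, $A_{s,k}(m)$ denotes the maximum number of distinct letters in a sequence on $m$ blocks that avoids alternations of length $s$ and in which every letter that occurs does so at least $k$ times. A $k$-chain on $[1,m]$ is a sequence of $k$ consecutive, disjoint, nonempty intervals of integers $[a_0,a_1]\,[a_1+1,a_2]\cdots[a_{k-1}+1,a_k]$ with integers $1\leq a_0\leq a_1<a_2<\cdots<a_k\leq m$. An $s$-tuple is a set of $s$ distinct integers; it stabs a chain if each of its elements lies in an interval of the chain, with different elements lying in different intervals. $\zeta_{s,k}(m)$ is the minimum size of a collection of $s$-tuples such that every $k$-chain on $[1,m]$ is stabbed by some $s$-tuple in the collection. *)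

theory Defs
  imports Main "HOL-Library.Sublist" "HOL-Library.Extended_Nat"
begin

definition on_blocks :: "nat \<Rightarrow> 'a list \<Rightarrow> bool" where
  "on_blocks m xs \<longleftrightarrow>
     (\<exists>bs. length bs = m \<and> (\<forall>b \<in> set bs. distinct b) \<and> xs = concat bs)"

definition alternation :: "nat \<Rightarrow> 'a \<Rightarrow> 'a \<Rightarrow> 'a list" where
  "alternation s a b = map (\<lambda>i. if even i then a else b) [0..<s]"

definition avoids_alternations :: "nat \<Rightarrow> 'a list \<Rightarrow> bool" where
  "avoids_alternations s xs \<longleftrightarrow>
     (\<forall>a b. a \<noteq> b \<longrightarrow> \<not> subseq (alternation s a b) xs)"

text \<open>
  Letters are natural numbers; since sequences are finite, any countably infinite
  alphabet gives the same numbers. The maximum is a supremum in the extended naturals,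
  hence infinite if the number of letters is unbounded. It is taken over a
  nonempty set (the empty sequence qualifies), so a finite value is attained.
\<close>

definition A :: "nat \<Rightarrow> nat \<Rightarrow> nat \<Rightarrow> enat" where
  "A s k m = Sup {enat (card (set xs)) | xs :: nat list.
     on_blocks m xs \<and> avoids_alternations s xs \<and>
     (\<forall>x \<in> set xs. k \<le> count_list xs x)}"

text \<open>A chain is the list of its intervals, in increasing order; \<open>k\<close> is meant to be positive.\<close>

definition is_chain :: "nat \<Rightarrow> nat \<Rightarrow> int set list \<Rightarrow> bool" where
  "is_chain k m C \<longleftrightarrow>
     (\<exists>a :: nat \<Rightarrow> int.
        1 \<le> a 0 \<and> a 0 \<le> a 1 \<and> (\<forall>i. 1 \<le> i \<and> i < k \<longrightarrow> a i < a (i + 1)) \<and> a k \<le> int m \<and>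
        C = map (\<lambda>i. if i = 0 then {a 0..a 1} else {a i + 1..a (i + 1)}) [0..<k])"

definition is_tuple :: "nat \<Rightarrow> int set \<Rightarrow> bool" where
  "is_tuple s T \<longleftrightarrow> finite T \<and> card T = s"

definition stabs :: "int set \<Rightarrow> int set list \<Rightarrow> bool" where
  "stabs T C \<longleftrightarrow>
     (\<exists>f. inj_on f T \<and> (\<forall>x \<in> T. f x < length C \<and> x \<in> C ! f x))"

text \<open>
  The infimum in the extended naturals is attained whenever some finite stabbing
  collection exists, and is infinite otherwise; the latter happens only for
  \<open>k < s\<close>, where no \<open>s\<close>-tuple can stab a \<open>k\<close>-chain.
\<close>

definition zeta :: "nat \<Rightarrow> nat \<Rightarrow> nat \<Rightarrow> enat" where
  "zeta s k m = Inf {enat (card F) | F :: int set set.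
     finite F \<and> (\<forall>T \<in> F. is_tuple s T) \<and>
     (\<forall>C. is_chain k m C \<longrightarrow> (\<exists>T \<in> F. stabs T C))}"

end

theory Submission imports Defs begin

text \<open>
  Number the blocks from 0 to m, and let the integer t in [1,m] stand for the cut just before
  block t. The first k+1 blocks containing a letter determine the k-chain of
  the cuts between consecutive ones; an s-tuple stabbing it cuts the sequence into s+1 parts that
  all contain the letter. Two distinct letters cannot share an s-tuple: both would occur in each of
  the s+1 parts, and two letters from the first part and one from every other part would form an
  alternation of length s+2. Hence letters inject into any stabbing collection.
\<close>

definition occ :: "'a list list \<Rightarrow> 'a \<Rightarrow> nat set" where
  "occ bs x = {i. i < length bs \<and> x \<in> set (bs ! i)}"

text \<open>Position \<open>p\<close> is left of cut \<open>t\<close> iff \<open>int p < t\<close>.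
  The first clause puts a position of \<open>P\<close> in the two outer parts, the second in every
  part between two cuts.\<close>

definition separates :: "int set \<Rightarrow> nat set \<Rightarrow> bool" where
  "separates T P \<longleftrightarrow>
     (\<forall>t \<in> T. (\<exists>p \<in> P. int p < t) \<and> (\<exists>p \<in> P. t \<le> int p)) \<and>
     (\<forall>t \<in> T. \<forall>u \<in> T. t < u \<longrightarrow> (\<exists>p \<in> P. t \<le> int p \<and> int p < u))"

lemma finite_occ [simp]: "finite (occ bs x)"
  by (simp add: occ_def)

lemma distinct_count_list: "distinct xs \<Longrightarrow> count_list xs x = (if x \<in> set xs then 1 else 0)"
  by (induction xs) auto

text \<open>Its letters being distinct, a block contributes at most one occurrence of
  \<open>x\<close>.\<close>

lemma card_occ:
  assumes "\<forall>b \<in> set bs. distinct b"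
  shows "card (occ bs x) = count_list (concat bs) x"
proof -
  have "count_list (concat bs) x = length (filter (\<lambda>b. x \<in> set b) bs)"
    using assms by (induction bs) (auto simp: distinct_count_list count_list_0_iff)
  then show ?thesis
    by (simp add: occ_def length_filter_conv_card)
qed

lemma separates_mono: "separates T P \<Longrightarrow> S \<subseteq> T \<Longrightarrow> separates S P"
  unfolding separates_def by blast

lemma separates_superset: "separates T P \<Longrightarrow> P \<subseteq> Q \<Longrightarrow> separates T Q"
  unfolding separates_def by (meson subsetD)

lemma is_chain_gaps:
  fixes L :: "nat list"
  assumes "sorted_wrt (<) L" "length L = k + 1" "1 \<le> k" "\<forall>p \<in> set L. p \<le> m"
  shows "is_chain k m (map (\<lambda>i. {int (L ! i) + 1..int (L ! (i + 1))}) [0..<k])"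
  unfolding is_chain_def
\<comment> \<open>A chain's first interval starts at \<open>a 0\<close>, a later one at
  \<open>a i + 1\<close>. Adding 1 to \<open>L ! 0\<close> evens this out and gives
  \<open>1 \<le> a 0\<close> although positions start at 0.\<close>
proof (intro exI[of _ "\<lambda>i. if i = 0 then int (L ! 0) + 1 else int (L ! i)"] conjI)
  let ?a = "\<lambda>i. if i = 0 then int (L ! 0) + 1 else int (L ! i)"
  have mono: "L ! i < L ! (i + 1)" if "i < k" for i
    using assms that by (simp add: sorted_wrt_nth_less)
  show "1 \<le> ?a 0" by simp
  show "?a 0 \<le> ?a 1" using mono[of 0] assms by simp
  show "\<forall>i. 1 \<le> i \<and> i < k \<longrightarrow> ?a i < ?a (i + 1)" using mono by simp
  show "?a k \<le> int m" using assms by simp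
qed auto

text \<open>The ends of the gap containing \<open>t\<close> are positions on either side of
  \<open>t\<close>. Cuts \<open>t < u\<close> lie in different gaps, so \<open>f t < f u\<close>,
  and the right end of the gap of \<open>t\<close> lies between the two cuts.\<close>

lemma stabs_gaps_separates:
  fixes L :: "nat list"
  assumes L: "sorted_wrt (<) L" "length L = k + 1"
    and "stabs T (map (\<lambda>i. {int (L ! i) + 1..int (L ! (i + 1))}) [0..<k])"
  shows "separates T (set L)"
proof -
  obtain f where inj: "inj_on f T"
    and f: "\<And>t. t \<in> T \<Longrightarrow> f t < k \<and> int (L ! f t) < t \<and> t \<le> int (L ! (f t + 1))"
    using assms(3) unfolding stabs_def by fastforce
  have mono: "L ! i \<le> L ! j" if "i \<le> j" "j \<le> k" for i j
    using L that by (simp add: strict_sorted_imp_sorted sorted_nth_mono)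
  have mem: "L ! i \<in> set L" if "i \<le> k" for i
    using L that by simp
  have "\<exists>p \<in> set L. t \<le> int p \<and> int p < u" if tu: "t \<in> T" "u \<in> T" "t < u" for t u
  proof -
    have "f t \<noteq> f u" using inj tu by (auto dest: inj_onD)
    moreover have "\<not> f u < f t"
    proof
      assume "f u < f t"
      then have "L ! (f u + 1) \<le> L ! f t" using f[OF tu(1)] by (intro mono) auto
      then show False using f[OF tu(1)] f[OF tu(2)] tu by linarith
    qed
    ultimately have "L ! (f t + 1) \<le> L ! f u"
      using f[OF tu(2)] by (intro mono) auto
    then show ?thesis
      using f[OF tu(1)] f[OF tu(2)] mem[of "f t + 1"]
      by (intro bexI[of _ "L ! (f t + 1)"]) auto
  qed
  moreover have "(\<exists>p \<in> set L. int p < t) \<and> (\<exists>p \<in> set L. t \<le> int p)" if "t \<in> T" for t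
    using f[OF that] mem[of "f t"] mem[of "f t + 1"] by auto
  ultimately show ?thesis
    unfolding separates_def by blast
qed

lemma chain_of_subset:
  assumes "finite P" "k + 1 \<le> card P" "1 \<le> k" "\<forall>p \<in> P. p \<le> m"
  obtains C where "is_chain k m C" "\<And>T. stabs T C \<Longrightarrow> separates T P"
proof -
  define L where "L = take (k + 1) (sorted_list_of_set P)"
  have L: "sorted_wrt (<) L" "length L = k + 1" "set L \<subseteq> P"
    using assms set_take_subset[of "k + 1" "sorted_list_of_set P"]
    by (auto simp: L_def sorted_wrt_take)
  show ?thesis
    \<comment> \<open>What separates the chosen \<open>k + 1\<close> positions also separates all of
      \<open>P\<close>.\<close>
    using is_chain_gaps[of L k m] stabs_gaps_separates[of L k] L assms
    by (intro that) (auto intro: separates_superset)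
qed

lemma alternation_0 [simp]: "alternation 0 a b = []"
  by (simp add: alternation_def)

lemma alternation_Suc: "alternation (Suc n) a b = a # alternation n b a"
  by (simp add: alternation_def upt_conv_Cons map_Suc_upt[symmetric] del: upt_Suc)

lemma subseq_pair:
  assumes "a \<in> set xs" "b \<in> set xs" "a \<noteq> b"
  shows "subseq [a, b] xs \<or> subseq [b, a] xs"
  using assms
proof (induction xs)
  case (Cons x xs)
  then show ?case by (cases "x = a"; cases "x = b") (auto simp: subseq_singleton_left)
qed simp

text \<open>Induction on the cuts: take \<open>a\<close> from the part just after the first cut,
  then continue behind that block with the letters swapped.\<close>

lemma subseq_alternation_drop:
  assumes "sorted_wrt (<) ts" "separates (set ts) (occ bs a)" "separates (set ts) (occ bs b)"
    and "\<forall>t \<in> set ts. int n \<le> t"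
  shows "subseq (alternation (length ts) a b) (concat (drop n bs))"
  using assms
proof (induction ts arbitrary: a b n)
  case (Cons t ts)
  \<comment> \<open>If \<open>t\<close> is the last cut, any occurrence after it will do; otherwise
    one before the next cut, hence before all later ones.\<close>
  have "\<exists>p \<in> occ bs a. t \<le> int p \<and> (\<forall>u \<in> set ts. int p < u)"
  proof (cases ts)
    case Nil
    then show ?thesis using Cons.prems by (auto simp: separates_def)
  next
    case (Cons u us)
    then obtain p where "p \<in> occ bs a" "t \<le> int p" "int p < u"
      using Cons.prems(1,2) by (auto simp: separates_def)
    then show ?thesis
      using Cons.prems(1) Cons by fastforce
  qed
  then obtain p where p: "p \<in> occ bs a" "t \<le> int p" "\<forall>u \<in> set ts. int p < u"
    by blast
  have np: "n \<le> p" "p < length bs" "a \<in> set (bs ! p)"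
    using Cons.prems p by (auto simp: occ_def)
  \<comment> \<open>The remaining cuts exceed \<open>p\<close>, so they are at least
    \<open>Suc p\<close>, as the induction hypothesis demands.\<close>
  have "subseq (alternation (length ts) b a) (concat (drop (Suc p) bs))"
    using Cons.prems p
    by (intro Cons.IH) (auto intro: separates_mono)
  then have "subseq ([a] @ alternation (length ts) b a) (bs ! p @ concat (drop (Suc p) bs))"
    using np by (intro list_emb_append_mono) (simp_all add: subseq_singleton_left)
  then have "subseq (alternation (length (t # ts)) a b) (concat (drop p bs))"
    using np by (simp add: alternation_Suc Cons_nth_drop_Suc[symmetric])
  moreover have "drop n bs = take (p - n) (drop n bs) @ drop p bs"
    using np append_take_drop_id[of "p - n" "drop n bs"] by simp
  then have "concat (drop n bs) = concat (take (p - n) (drop n bs)) @ concat (drop p bs)"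
    by (metis concat_append)
  ultimately show ?case
    by (simp add: list_emb_append2)
qed simp

lemma common_separator_alternation:
  assumes "finite T" "T \<noteq> {}" "a \<noteq> b"
    and sep: "separates T (occ bs a)" "separates T (occ bs b)"
  shows "\<not> avoids_alternations (card T + 2) (concat bs)"
proof -
  define n where "n = nat (Min T)"
  have Min: "Min T \<in> T" using assms by simp
  obtain p q where pq: "p \<in> occ bs a" "int p < Min T" "q \<in> occ bs b" "int q < Min T"
    using sep Min unfolding separates_def by blast
  \<comment> \<open>Some position precedes \<open>Min T\<close>, which is therefore positive, so
    \<open>nat\<close> loses nothing. The first \<open>n\<close> blocks form the part before all
    cuts.\<close>
  have n: "int n = Min T" using pq by (simp add: n_def)
  have first: "x \<in> set (concat (take n bs))" if "i \<in> occ bs x" "i < n" for x i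
    using that by (force simp: occ_def in_set_conv_nth)
  have rest: "subseq (alternation (card T) c d) (concat (drop n bs))"
    if "separates T (occ bs c)" "separates T (occ bs d)" for c d
    using subseq_alternation_drop[of "sorted_list_of_set T" bs c d n] that assms n by simp
  \<comment> \<open>The order in which the first part offers the two letters is unknown, so both
    orders are covered. After \<open>[c, d]\<close> the alternation resumes with
    \<open>c\<close>.\<close>
  have *: "subseq (alternation (card T + 2) c d) (concat bs)"
    if "subseq [c, d] (concat (take n bs))" "separates T (occ bs c)" "separates T (occ bs d)"
    for c d
  proof -
    have "subseq ([c, d] @ alternation (card T) c d) (concat (take n bs) @ concat (drop n bs))"
      using that rest by (intro list_emb_append_mono) auto
    then show ?thesis
      by (simp add: alternation_Suc flip: concat_append)
  qed
  have "subseq [a, b] (concat (take n bs)) \<or> subseq [b, a] (concat (take n bs))"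
    using first pq n \<open>a \<noteq> b\<close> by (intro subseq_pair) auto
  then show ?thesis
    using * sep \<open>a \<noteq> b\<close> unfolding avoids_alternations_def by metis
qed

lemma card_letters_le:
  assumes "1 \<le> s" "s \<le> k"
    and "on_blocks (m + 1) xs" "avoids_alternations (s + 2) xs"
    and count: "\<forall>x \<in> set xs. k + 1 \<le> count_list xs x"
    and F: "finite F" "\<forall>T \<in> F. is_tuple s T" "\<forall>C. is_chain k m C \<longrightarrow> (\<exists>T \<in> F. stabs T C)"
  shows "card (set xs) \<le> card F"
proof -
  obtain bs where bs: "length bs = m + 1" "\<forall>b \<in> set bs. distinct b" "xs = concat bs"
    using assms(3) unfolding on_blocks_def by blast
  have "\<exists>T \<in> F. separates T (occ bs x)" if x: "x \<in> set xs" for x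
  proof -
    have "k + 1 \<le> card (occ bs x)" using bspec[OF count x] bs by (simp add: card_occ)
    moreover have "\<forall>p \<in> occ bs x. p \<le> m" using bs by (simp add: occ_def)
    ultimately obtain C where "is_chain k m C" "\<And>T. stabs T C \<Longrightarrow> separates T (occ bs x)"
      using chain_of_subset[of "occ bs x" k m] assms by auto
    then show ?thesis using F by blast
  qed
  then obtain g where g: "\<And>x. x \<in> set xs \<Longrightarrow> g x \<in> F \<and> separates (g x) (occ bs x)"
    by metis
  have "inj_on g (set xs)"
  proof (rule inj_onI, rule ccontr)
    fix x y assume xy: "x \<in> set xs" "y \<in> set xs" "g x = g y" "x \<noteq> y"
    have T: "finite (g x)" "card (g x) = s"
      using F g xy by (auto simp: is_tuple_def)
    \<comment> \<open>A first cut must exist for there to be a part before it.\<close>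
    then have "g x \<noteq> {}" using \<open>1 \<le> s\<close> by auto
    then have "\<not> avoids_alternations (s + 2) xs"
      using common_separator_alternation[of "g x" x y bs] g[OF xy(1)] g[OF xy(2)] xy T bs by simp
    then show False using assms by simp
  qed
  then show ?thesis
    using g F by (intro card_inj_on_le) auto
qed

theorem corollary2p2:
  fixes s k m :: nat
  assumes "1 \<le> s" and "s \<le> k" and "k \<le> m"
  shows "A (s + 2) (k + 1) (m + 1) \<le> zeta s k m"
  unfolding A_def zeta_def
  \<comment> \<open>Bounding every admissible sequence by every stabbing collection bounds the
    supremum by the infimum.\<close>
  by (intro Sup_least Inf_greatest) (use card_letters_le[OF assms(1,2)] in auto)

end
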